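(* Let $\beta>1$ with $\beta\notin\mathbb N$, and let $\mathcal A=\{0,1,\dots,\lfloor\beta\rfloor\}$. Then Lebesgue-almost every $x\in J_{-\beta,\mathcal A}$ has no optimal $(-\beta,\mathcal A)$-representation.
   Context: A $(-\beta,\mathcal A)$-representation of a real $x$ is an expression $x=\sum_{i=1}^\infty \frac{b_i}{(-\beta)^i}$ with all $b_i\in\mathcal A$; $J_{-\beta,\mathcal A}$ is the set of reals having such a representation (it equals the interval $[-\frac{\beta\lfloor\beta\rfloor}{\beta^2-1},\frac{\lfloor\beta\rfloor}{\beta^2-1}]$). A representation $x=\sum_{i\ge1}\frac{c_i}{(-\beta)^i}$ is optimal if for every other $(-\beta,\mathcal A)$-representation $x=\sum_{i\ge1}\frac{b_i}{(-\beta)^i}$ one has $\big|x-\sum_{i=1}^n\frac{c_i}{(-\beta)^i}\big|\le\big|x-\sum_{i=1}^n\frac{b_i}{(-\beta)^i}\big|$ for all $n\ge1$. *)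

theory Defs
  imports "HOL-Analysis.Analysis"
begin

(* Digit sequences are indexed from 1; the value at index 0 is never used. *)

definition is_rep :: "real \<Rightarrow> int set \<Rightarrow> real \<Rightarrow> (nat \<Rightarrow> int) \<Rightarrow> bool" where
  "is_rep \<beta> A x b \<longleftrightarrow>
     (\<forall>i\<ge>1. b i \<in> A) \<and> (\<lambda>i. of_int (b (Suc i)) / (- \<beta>) ^ Suc i) sums x"

definition J :: "real \<Rightarrow> int set \<Rightarrow> real set" where
  "J \<beta> A = {x. \<exists>b. is_rep \<beta> A x b}"

definition is_optimal_rep :: "real \<Rightarrow> int set \<Rightarrow> real \<Rightarrow> (nat \<Rightarrow> int) \<Rightarrow> bool" where
  "is_optimal_rep \<beta> A x c \<longleftrightarrow> is_rep \<beta> A x c \<and>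
     (\<forall>b. is_rep \<beta> A x b \<longrightarrow>
        (\<forall>n\<ge>1. \<bar>x - (\<Sum>i=1..n. of_int (c i) / (- \<beta>) ^ i)\<bar>
             \<le> \<bar>x - (\<Sum>i=1..n. of_int (b i) / (- \<beta>) ^ i)\<bar>))"

end

theory Submission
  imports Defs
begin

text \<open>
  Let \<open>m = \<lfloor>\<beta>\<rfloor>\<close> and let \<open>N\<close> be the set of points with an optimal representation. If \<open>x \<in> N\<close> has
  first digit \<open>k\<close>, the scaled remainder \<open>- \<beta> * x - k\<close> is again in \<open>N\<close>. Among the admissible remainders
  the first step has to choose the one closest to 0; but when \<open>k < m\<close> and the remainder is close to
  the upper end of its range, the digits \<open>k + 1, m\<close> give a better approximation after two steps.
  Hence \<open>N\<close> avoids an interval of fixed length on one side of every discontinuity of the first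
  digit, and so does its closure \<open>K\<close>, which is still invariant.

  If \<open>K\<close> has sufficiently high density in an interval \<open>I\<close>, then \<open>I\<close> contains no complete gap, so all points of
  \<open>K \<inter> I\<close> have the same first digit. The expanding affine map for that digit yields another interval
  of high density in which \<open>K\<close> has \<open>\<beta>\<close> times the measure. This cannot be repeated forever, so the
  density of \<open>K\<close> in intervals is bounded away from 1, and \<open>K\<close> is a null set.
\<close>

section \<open>Null sets from density bounds and expanding maps\<close>

text \<open>An open \<open>U\<close> containing \<open>K\<close> can be chosen to exceed it in
  measure by at most \<open>e\<close>, and by compactness finitely many components of
  \<open>U\<close>, which are disjoint intervals, cover \<open>K\<close>. Summing the density bound
  over them bounds the measure of \<open>K\<close> by \<open>q\<close> times itself plus
  \<open>q * e\<close>; then \<open>e\<close> tends to 0.\<close>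

lemma negligible_if_density_bounded:
  fixes K :: "real set"
  assumes K: "compact K" and q: "0 \<le> q" "q < 1"
    and dens: "\<And>I. is_interval I \<Longrightarrow> I \<in> lmeasurable \<Longrightarrow>
      measure lebesgue (K \<inter> I) \<le> q * measure lebesgue I"
  shows "negligible K"
proof -
  have Km: "K \<in> lmeasurable"
    using K by (rule lmeasurable_compact)
  have le: "measure lebesgue K \<le> q * (measure lebesgue K + e)" if e: "e > 0" for e
  proof -
    obtain U where U: "open U" "K \<subseteq> U" "U - K \<in> lmeasurable"
      "emeasure lebesgue (U - K) < ennreal e"
      using sets_lebesgue_outer_open[of K e] Km e by blast
    have UK: "measure lebesgue (U - K) < e"
      using U(3,4) e by (simp add: emeasure_eq_measure2 ennreal_less_iff)
    have "U = K \<union> (U - K)"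
      using U(2) by blast
    then have Um: "U \<in> lmeasurable" and mU: "measure lebesgue U \<le> measure lebesgue K + e"
      using fmeasurable.Un[OF Km U(3)] measure_Un_le[of K lebesgue "U - K"] Km U(3) UK
      by (auto dest: fmeasurableD)
    obtain \<C> where \<C>: "\<C> \<subseteq> components U" "finite \<C>" "K \<subseteq> \<Union>\<C>"
      using compactE[OF K, of "components U"] U(1,2) open_components Union_components[of U]
      by metis
    have Cm: "C \<in> lmeasurable" if "C \<in> \<C>" for C
    proof -
      have "C \<subseteq> U" "open C"
        using that \<C>(1) U(1) in_components_subset open_components by blast+
      then show ?thesis
        using Um by (metis borel_open fmeasurableI2 lborelD sets_completionI_sets)
    qed
    have disj: "pairwise disjnt \<C>"
      using pairwise_disjoint_components[of U] \<C>(1) 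
      by (auto simp: pairwise_def disjnt_def)
    have "measure lebesgue K = measure lebesgue (\<Union>C\<in>\<C>. K \<inter> C)"
      using \<C>(3) by (metis Int_Union inf.absorb1)
    also have "\<dots> \<le> (\<Sum>C\<in>\<C>. measure lebesgue (K \<inter> C))"
      using \<C>(2) Km Cm by (intro measure_UNION_le) (auto dest: fmeasurableD)
    also have "\<dots> \<le> (\<Sum>C\<in>\<C>. q * measure lebesgue C)"
      using \<C>(1) Cm
      by (intro sum_mono dens)
        (auto simp: is_interval_connected_1 dest: in_components_connected)
    also have "\<dots> = q * measure lebesgue (\<Union>\<C>)"
      using \<C>(2) Cm disj
      by (subst measure_negligible_finite_Union)
        (auto simp: sum_distrib_left pairwise_def disjnt_def)
    also have "\<dots> \<le> q * measure lebesgue U"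
    proof (intro mult_left_mono measure_mono_fmeasurable)
      show "\<Union>\<C> \<subseteq> U"
        using \<C>(1) in_components_subset by blast
      show "\<Union>\<C> \<in> sets lebesgue"
        using \<C>(2) Cm by (auto dest: fmeasurableD)
    qed (use q Um in auto)
    also have "\<dots> \<le> q * (measure lebesgue K + e)"
      using mU q by (intro mult_left_mono) auto
    finally show ?thesis .
  qed
  have "(1 - q) * measure lebesgue K \<le> 0"
  proof (rule field_le_epsilon)
    fix e :: real
    assume e: "0 < e"
    have "q * e \<le> e"
      using q e by (simp add: mult_left_le_one_le)
    then show "(1 - q) * measure lebesgue K \<le> 0 + e"
      using le[OF e] by (simp add: algebra_simps)
  qed
  then have "measure lebesgue K = 0"
    using q by (metis diff_gt_0_iff_gt measure_nonneg mult_le_0_iff order_antisym not_less)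
  then show ?thesis
    using Km by (simp add: negligible_iff_measure0)
qed

text \<open>This separates the dynamics from the digits: \<open>D x\<close> will be a first digit of
  \<open>x\<close>, and \<open>gap\<close> will come from the remainders that optimality
  forbids.\<close>

lemma negligible_if_expanding_with_gaps:
  fixes K :: "real set" and D :: "real \<Rightarrow> real"
  assumes K: "compact K" and \<beta>: "\<beta> > 1" and \<delta>: "\<delta> > 0"
    and inv: "\<And>x. x \<in> K \<Longrightarrow> - \<beta> * x - D x \<in> K"
    and gap: "\<And>x y. x \<in> K \<Longrightarrow> y \<in> K \<Longrightarrow> x < y \<Longrightarrow> D x \<noteq> D y \<Longrightarrow>
      \<exists>u. x \<le> u \<and> u + \<delta> \<le> y \<and> {u<..<u + \<delta>} \<inter> K = {}"
  shows "negligible K"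
proof -
  let ?\<mu> = "measure lebesgue"
  obtain R0 where R0: "\<And>x. x \<in> K \<Longrightarrow> \<bar>x\<bar> \<le> R0"
    using compact_imp_bounded[OF K] by (auto simp: bounded_iff)
  define R where "R = max R0 \<delta>"
  define W where "W = {-R..R}"
  \<comment> \<open>Removing a gap of length \<open>\<delta>\<close> from an interval of length at
    most \<open>2 * R\<close> leaves at most the share \<open>q\<close> of it. As
    \<open>R \<ge> \<delta>\<close>, \<open>q\<close> is at least 1/2.\<close>
  define q where "q = 1 - \<delta> / (2 * R)"
  have R: "R > 0" "R \<ge> \<delta>"
    using \<delta> by (auto simp: R_def)
  have q: "0 < q" "q < 1"
    using R \<delta> by (auto simp: q_def)
  have KW: "K \<subseteq> W"
    using R0 by (force simp: W_def R_def abs_le_iff)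
  have Km: "K \<in> lmeasurable"
    using K by (rule lmeasurable_compact)
  have Wm: "W \<in> lmeasurable"
    by (simp add: W_def)
  have Im: "I \<in> lmeasurable" if "is_interval I" "I \<subseteq> W" for I
    using that bounded_subset[of W I] by (auto simp: W_def intro: measurable_convex is_interval_convex)
  have KIm: "K \<inter> I \<in> lmeasurable" if "is_interval I" "I \<subseteq> W" for I
    using Im[OF that] Km by blast
  define bad where
    "bad I \<longleftrightarrow> is_interval I \<and> I \<subseteq> W \<and> q * ?\<mu> I < ?\<mu> (K \<inter> I)" for I
  have step: "\<exists>I'. bad I' \<and> ?\<mu> (K \<inter> I') \<ge> \<beta> * ?\<mu> (K \<inter> I)" if "bad I" for I
  proof -
    have I: "is_interval I" "I \<subseteq> W" "q * ?\<mu> I < ?\<mu> (K \<inter> I)"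
      using that by (auto simp: bad_def)
    have same: "D x = D y" if xy: "x \<in> K \<inter> I" "y \<in> K \<inter> I" "x < y" for x y
    proof (rule ccontr)
      assume "D x \<noteq> D y"
      then obtain u where u: "x \<le> u" "u + \<delta> \<le> y" "{u<..<u + \<delta>} \<inter> K = {}"
        using gap xy by blast
      let ?G = "{u<..<u + \<delta>}"
      have GI: "?G \<subseteq> I"
      proof
        fix z assume "z \<in> ?G"
        then show "z \<in> I"
          using u(1,2) xy I(1) by (auto intro: mem_is_interval_1_I[of I x y z])
      qed
      have "?\<mu> (K \<inter> I) \<le> ?\<mu> (I - ?G)"
        using u(3) KIm[OF I(1,2)] Im[OF I(1,2)]
        by (intro measure_mono_fmeasurable) (auto dest: fmeasurableD)
      also have "\<dots> = ?\<mu> I - \<delta>"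
        using GI Im[OF I(1,2)] \<delta> by (subst measurable_measure_Diff) auto
      also have "\<dots> \<le> q * ?\<mu> I"
      proof -
        have "?\<mu> I \<le> ?\<mu> W"
          using I(2) Im[OF I(1,2)] Wm by (intro measure_mono_fmeasurable) auto
        also have "\<dots> = 2 * R"
          using R by (simp add: W_def)
        finally show ?thesis
          using R \<delta> by (simp add: q_def field_simps)
      qed
      finally show False
        using I(3) by simp
    qed
    have "K \<inter> I \<noteq> {}"
      using I(3) q by (metis less_le_not_le measure_empty measure_nonneg mult_nonneg_nonneg order_less_imp_le)
    then obtain k where k: "\<And>x. x \<in> K \<inter> I \<Longrightarrow> D x = k"
      using same by (metis linorder_neqE ex_in_conv)
    define f where "f x = - \<beta> * x - k" for x
    have f_eq: "f = (\<lambda>x. (-\<beta>) *\<^sub>R x + (-k))"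
      by (auto simp: f_def)
    have mf: "?\<mu> (f ` S) = \<beta> * ?\<mu> S" for S
      using measure_lebesgue_affine[of "-\<beta>" "-k" S] \<beta> by (simp add: f_eq)
    have cf: "continuous_on X f" for X
      unfolding f_def by (intro continuous_intros)
    have fint: "is_interval (f ` I)"
      using I(1) cf by (simp add: is_interval_connected_1 connected_continuous_image)
    have fIm: "f ` I \<in> lmeasurable"
    proof (rule measurable_convex)
      show "convex (f ` I)"
        using fint by (simp add: is_interval_convex)
      have "bounded (f ` W)"
        using cf by (intro compact_imp_bounded compact_continuous_image) (simp_all add: W_def)
      then show "bounded (f ` I)"
        using I(2) by (meson bounded_subset image_mono)
    qed
    have "inj f"
      using \<beta> by (auto simp: inj_def f_def)
    then have "f ` (K \<inter> I) = f ` K \<inter> f ` I"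
      by (rule image_Int)
    moreover have "f ` K \<in> lmeasurable"
      using K cf by (intro lmeasurable_compact compact_continuous_image)
    ultimately have fKIm: "f ` (K \<inter> I) \<in> sets lebesgue"
      using fIm by (auto dest: fmeasurableD)
    have sub: "f ` (K \<inter> I) \<subseteq> K \<inter> (f ` I \<inter> W)"
      using inv k KW by (fastforce simp: f_def)
    \<comment> \<open>The image of \<open>I\<close> may leave \<open>W\<close>, but the image of
      \<open>K \<inter> I\<close> stays in \<open>K\<close> and hence in \<open>W\<close>. Cutting
      with \<open>W\<close> therefore shortens the interval without losing any of that set.\<close>
    have int': "is_interval (f ` I \<inter> W)"
      using fint by (simp add: W_def is_interval_Int)
    have ge: "\<beta> * ?\<mu> (K \<inter> I) \<le> ?\<mu> (K \<inter> (f ` I \<inter> W))"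
      unfolding mf[symmetric] using sub fKIm KIm[OF int']
      by (intro measure_mono_fmeasurable) auto
    have "q * ?\<mu> (f ` I \<inter> W) \<le> q * ?\<mu> (f ` I)"
      using q fIm Wm by (intro mult_left_mono measure_mono_fmeasurable) (auto dest: fmeasurableD)
    also have "\<dots> = \<beta> * (q * ?\<mu> I)"
      by (simp add: mf)
    also have "\<dots> < \<beta> * ?\<mu> (K \<inter> I)"
      using I(3) \<beta> by simp
    finally have "bad (f ` I \<inter> W)"
      using ge int' by (auto simp: bad_def)
    then show ?thesis
      using ge by blast
  qed
  have not_bad: "\<not> bad I" for I
  proof
    assume I: "bad I"
    let ?M = "{?\<mu> (K \<inter> I) |I. bad I}"
    have pos: "?\<mu> (K \<inter> I) > 0" if "bad I" for I
      using that q by (auto simp: bad_def intro: le_less_trans[rotated])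
    have bdd: "bdd_above ?M"
    proof (rule bdd_aboveI)
      fix z assume "z \<in> ?M"
      then obtain I where "bad I" "z = ?\<mu> (K \<inter> I)"
        by blast
      then show "z \<le> ?\<mu> K"
        using KIm[of I] Km by (auto simp: bad_def intro!: measure_mono_fmeasurable dest: fmeasurableD)
    qed
    \<comment> \<open>Instead of iterating \<open>step\<close>, take a bad interval whose value is
      within a factor \<open>\<beta>\<close> of the finite supremum; a single step then exceeds the
      supremum.\<close>
    have "Sup ?M > 0"
      using pos[OF I] I cSup_upper[OF _ bdd] by (smt (verit) mem_Collect_eq)
    then have "Sup ?M / \<beta> < Sup ?M"
      using \<beta> by (simp add: field_simps)
    then obtain I1 where I1: "bad I1" "Sup ?M / \<beta> < ?\<mu> (K \<inter> I1)"
      using I by (subst (asm) less_cSup_iff[OF _ bdd]) auto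
    obtain I2 where I2: "bad I2" "?\<mu> (K \<inter> I2) \<ge> \<beta> * ?\<mu> (K \<inter> I1)"
      using step[OF I1(1)] by blast
    have "?\<mu> (K \<inter> I2) \<le> Sup ?M"
      using I2(1) by (intro cSup_upper[OF _ bdd]) blast
    then show False
      using I1(2) I2(2) \<beta> by (simp add: field_simps)
  qed
  show ?thesis
  proof (rule negligible_if_density_bounded[OF K])
    fix I :: "real set"
    assume I: "is_interval I" "I \<in> lmeasurable"
    have "is_interval (I \<inter> W)"
      using I(1) by (simp add: W_def is_interval_Int)
    then have "?\<mu> (K \<inter> (I \<inter> W)) \<le> q * ?\<mu> (I \<inter> W)"
      using not_bad[of "I \<inter> W"] by (auto simp: bad_def)
    also have "\<dots> \<le> q * ?\<mu> I"
      using q I(2) Wm by (intro mult_left_mono measure_mono_fmeasurable) (auto dest: fmeasurableD)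
    also have "K \<inter> (I \<inter> W) = K \<inter> I"
      using KW by blast
    finally show "?\<mu> (K \<inter> I) \<le> q * ?\<mu> I" .
  qed (use q in auto)
qed

section \<open>Shifting representations and their optimality\<close>

lemma is_rep_shift_iff:
  assumes "\<beta> \<noteq> 0"
  shows "is_rep \<beta> A x c \<longleftrightarrow> c 1 \<in> A \<and> is_rep \<beta> A (- \<beta> * x - of_int (c 1)) (\<lambda>i. c (Suc i))"
proof -
  let ?f = "\<lambda>i. of_int (c (Suc i)) / (- \<beta>) ^ Suc i"
  have "?f sums x \<longleftrightarrow> (\<lambda>i. ?f (Suc i)) sums (x - ?f 0)"
    using sums_Suc_iff[of ?f "x - ?f 0"] by simp
  also have "\<dots> \<longleftrightarrow> (\<lambda>i. - \<beta> * ?f (Suc i)) sums (- \<beta> * (x - ?f 0))"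
    using assms by (intro sums_mult_iff[symmetric]) auto
  also have "(\<lambda>i. - \<beta> * ?f (Suc i)) = (\<lambda>i. of_int (c (Suc (Suc i))) / (- \<beta>) ^ Suc i)"
    using assms by (auto simp: field_simps)
  also have "- \<beta> * (x - ?f 0) = - \<beta> * x - of_int (c 1)"
    using assms by (simp add: field_simps)
  finally have *: "?f sums x \<longleftrightarrow>
    (\<lambda>i. of_int (c (Suc (Suc i))) / (- \<beta>) ^ Suc i) sums (- \<beta> * x - of_int (c 1))" .
  have "(\<forall>i\<ge>1. c i \<in> A) \<longleftrightarrow> c 1 \<in> A \<and> (\<forall>i\<ge>1. c (Suc i) \<in> A)"
    by (metis One_nat_def Suc_le_mono le_SucI not0_implies_Suc not_one_le_zero zero_le)
  then show ?thesis
    unfolding is_rep_def * by blast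
qed

text \<open>Dropping the first digit multiplies every later error by \<open>- \<beta>\<close>, so
  comparisons of errors carry over between a point and its scaled remainder.\<close>

lemma remainder_shift:
  fixes \<beta> x :: real and c :: "nat \<Rightarrow> int"
  assumes "\<beta> \<noteq> 0"
  shows "x - (\<Sum>i=1..Suc n. of_int (c i) / (- \<beta>) ^ i) =
    (- \<beta> * x - of_int (c 1) - (\<Sum>i=1..n. of_int (c (Suc i)) / (- \<beta>) ^ i)) / (- \<beta>)"
proof -
  have "(\<Sum>i=1..Suc n. of_int (c i) / (- \<beta>) ^ i) =
      of_int (c 1) / (- \<beta>) + (\<Sum>i=1..n. of_int (c (Suc i)) / (- \<beta>) ^ Suc i)"
    using sum.shift_bounds_cl_Suc_ivl[of "\<lambda>i. of_int (c i) / (- \<beta>) ^ i" 1 n]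
    by (subst sum.atLeast_Suc_atMost) auto
  also have "(\<Sum>i=1..n. of_int (c (Suc i)) / (- \<beta>) ^ Suc i) =
      (\<Sum>i=1..n. of_int (c (Suc i)) / (- \<beta>) ^ i) / (- \<beta>)"
    unfolding sum_divide_distrib by (simp add: mult.commute)
  finally show ?thesis
    using assms by (simp add: field_simps)
qed

lemma optimal_repD:
  assumes "is_optimal_rep \<beta> A x c" and "is_rep \<beta> A x b" and "n \<ge> 1"
  shows "\<bar>x - (\<Sum>i=1..n. of_int (c i) / (- \<beta>) ^ i)\<bar> \<le> \<bar>x - (\<Sum>i=1..n. of_int (b i) / (- \<beta>) ^ i)\<bar>"
  using assms unfolding is_optimal_rep_def by blast

text \<open>The first digit sits at index \<open>Suc 0\<close>; the 0 at index 0 is a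
  placeholder.\<close>

lemma is_rep_prepend:
  assumes "\<beta> \<noteq> 0" and "b \<in> A" and "is_rep \<beta> A (- \<beta> * x - of_int b) c"
  shows "is_rep \<beta> A x (\<lambda>i. case i of 0 \<Rightarrow> 0 | Suc 0 \<Rightarrow> b | Suc (Suc j) \<Rightarrow> c (Suc j))"
proof -
  have "is_rep \<beta> A t (\<lambda>i. case Suc i of 0 \<Rightarrow> 0 | Suc 0 \<Rightarrow> b | Suc (Suc j) \<Rightarrow> c (Suc j))
      \<longleftrightarrow> is_rep \<beta> A t c" for t
    unfolding is_rep_def by (auto split: nat.split simp: Suc_le_eq gr0_conv_Suc)
  then show ?thesis
    using assms by (subst is_rep_shift_iff) auto
qed

text \<open>A better representation of the scaled remainder, with \<open>c 1\<close> put in front,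
  would be a better representation of \<open>x\<close>.\<close>

lemma optimal_tail:
  assumes "\<beta> > 0" and "is_optimal_rep \<beta> A x c"
  shows "is_optimal_rep \<beta> A (- \<beta> * x - of_int (c 1)) (\<lambda>i. c (Suc i))"
  unfolding is_optimal_rep_def
proof (intro conjI allI impI)
  have c: "c 1 \<in> A" "is_rep \<beta> A (- \<beta> * x - of_int (c 1)) (\<lambda>i. c (Suc i))"
    using assms is_rep_shift_iff[of \<beta> A x c] by (auto simp: is_optimal_rep_def)
  show "is_rep \<beta> A (- \<beta> * x - of_int (c 1)) (\<lambda>i. c (Suc i))"
    by (fact c)
  fix b :: "nat \<Rightarrow> int" and n :: nat
  assume b: "is_rep \<beta> A (- \<beta> * x - of_int (c 1)) b" and n: "1 \<le> n"
  define d where "d = (\<lambda>i. case i of 0 \<Rightarrow> 0 | Suc 0 \<Rightarrow> c 1 | Suc (Suc j) \<Rightarrow> b (Suc j))"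
  have "is_rep \<beta> A x d"
    unfolding d_def using assms c b by (intro is_rep_prepend) auto
  then have "\<bar>x - (\<Sum>i=1..Suc n. of_int (c i) / (- \<beta>) ^ i)\<bar>
     \<le> \<bar>x - (\<Sum>i=1..Suc n. of_int (d i) / (- \<beta>) ^ i)\<bar>"
    by (rule optimal_repD[OF assms(2)]) simp
  moreover have "d 1 = c 1"
    by (simp add: d_def)
  moreover have "(\<Sum>i=1..n. of_int (d (Suc i)) / (- \<beta>) ^ i) = (\<Sum>i=1..n. of_int (b i) / (- \<beta>) ^ i)"
    by (intro sum.cong) (auto simp: d_def split: nat.split)
  ultimately show "\<bar>- \<beta> * x - of_int (c 1) - (\<Sum>i=1..n. of_int (c (Suc i)) / (- \<beta>) ^ i)\<bar>
    \<le> \<bar>- \<beta> * x - of_int (c 1) - (\<Sum>i=1..n. of_int (b i) / (- \<beta>) ^ i)\<bar>"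
    using assms(1) unfolding remainder_shift[OF less_imp_neq[OF assms(1), symmetric]]
    by (simp add: abs_divide divide_le_cancel)
qed

text \<open>Membership in \<open>J\<close> lets \<open>b\<close> be continued to a representation of
  \<open>x\<close>, which is compared with \<open>c\<close> at \<open>n = 1\<close>.\<close>

lemma optimal_first_digit:
  assumes \<beta>: "\<beta> > 0" and opt: "is_optimal_rep \<beta> A x c"
    and b: "b \<in> A" "- \<beta> * x - of_int b \<in> J \<beta> A"
  shows "\<bar>- \<beta> * x - of_int (c 1)\<bar> \<le> \<bar>- \<beta> * x - of_int b\<bar>"
proof -
  obtain e where e: "is_rep \<beta> A (- \<beta> * x - of_int b) e"
    using b by (auto simp: J_def)
  define d where "d = (\<lambda>i. case i of 0 \<Rightarrow> 0 | Suc 0 \<Rightarrow> b | Suc (Suc j) \<Rightarrow> e (Suc j))"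
  have "is_rep \<beta> A x d"
    unfolding d_def using \<beta> b e by (intro is_rep_prepend) auto
  then have "\<bar>x - (\<Sum>i=1..Suc 0. of_int (c i) / (- \<beta>) ^ i)\<bar>
     \<le> \<bar>x - (\<Sum>i=1..Suc 0. of_int (d i) / (- \<beta>) ^ i)\<bar>"
    by (rule optimal_repD[OF opt]) simp
  moreover have "d 1 = b"
    by (simp add: d_def)
  ultimately show ?thesis
    using \<beta> unfolding remainder_shift[OF less_imp_neq[OF \<beta>, symmetric]]
    by (simp add: abs_divide divide_le_cancel)
qed

text \<open>The same comparison at \<open>n = 2\<close>; the competitor may already differ in its
  first digit.\<close>

lemma optimal_second_digit:
  assumes \<beta>: "\<beta> > 0" and opt: "is_optimal_rep \<beta> A x c"
    and b: "b1 \<in> A" "b2 \<in> A" "- \<beta> * (- \<beta> * x - of_int b1) - of_int b2 \<in> J \<beta> A"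
  shows "\<bar>- \<beta> * (- \<beta> * x - of_int (c 1)) - of_int (c 2)\<bar>
    \<le> \<bar>- \<beta> * (- \<beta> * x - of_int b1) - of_int b2\<bar>"
proof -
  obtain e where e: "is_rep \<beta> A (- \<beta> * (- \<beta> * x - of_int b1) - of_int b2) e"
    using b by (auto simp: J_def)
  define d' where "d' = (\<lambda>i. case i of 0 \<Rightarrow> 0 | Suc 0 \<Rightarrow> b2 | Suc (Suc j) \<Rightarrow> e (Suc j))"
  have d': "is_rep \<beta> A (- \<beta> * x - of_int b1) d'"
    unfolding d'_def using \<beta> b e by (intro is_rep_prepend) auto
  define d where "d = (\<lambda>i. case i of 0 \<Rightarrow> 0 | Suc 0 \<Rightarrow> b1 | Suc (Suc j) \<Rightarrow> d' (Suc j))"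
  have "is_rep \<beta> A x d"
    unfolding d_def using \<beta> b d' by (intro is_rep_prepend) auto
  then have "\<bar>x - (\<Sum>i=1..Suc (Suc 0). of_int (c i) / (- \<beta>) ^ i)\<bar>
     \<le> \<bar>x - (\<Sum>i=1..Suc (Suc 0). of_int (d i) / (- \<beta>) ^ i)\<bar>"
    by (rule optimal_repD[OF opt]) simp
  moreover have "d 1 = b1" "d (Suc 1) = b2"
    by (simp_all add: d_def d'_def)
  ultimately show ?thesis
    using \<beta> unfolding remainder_shift[OF less_imp_neq[OF \<beta>, symmetric]]
    by (simp add: abs_divide divide_le_cancel numeral_2_eq_2)
qed

section \<open>The interval of representable numbers\<close>

text \<open>The ends are attained by digits alternating between 0 and \<open>m\<close>. Every point
  between them has a greedy expansion, because the interval has length at least 1 and so its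
  translates by the digits leave no holes.\<close>

lemma J_eq_interval:
  fixes \<beta> :: real and m :: int
  assumes \<beta>: "\<beta> > 1" and m: "\<beta> - 1 \<le> of_int m"
  defines "r \<equiv> of_int m / (\<beta>\<^sup>2 - 1)"
  shows "J \<beta> {0..m} = {- \<beta> * r..r}"
proof (intro equalityI subsetI)
  have \<beta>2: "\<beta>\<^sup>2 > 1"
    using \<beta> by simp
  have m0: "of_int m \<ge> (0::real)" "m \<ge> 0"
    using \<beta> m by linarith+
  \<comment> \<open>This says that multiplication by \<open>- \<beta>\<close> maps the interval onto
    the one from \<open>- \<beta> * r\<close> to \<open>of_int m + r\<close>, the span of the
    translates by 0 to \<open>m\<close>.\<close>
  have r_eq: "\<beta>\<^sup>2 * r = of_int m + r"
    using \<beta>2 by (simp add: r_def field_simps)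
  have len: "1 \<le> r + \<beta> * r"
  proof -
    have "\<beta>\<^sup>2 - 1 = (\<beta> + 1) * (\<beta> - 1)"
      by (simp add: power2_eq_square algebra_simps)
    then have "r + \<beta> * r = of_int m / (\<beta> - 1)"
      using \<beta> by (simp add: r_def divide_simps) (simp add: algebra_simps)
    then show ?thesis
      using \<beta> m by simp
  qed
  {
    fix x assume "x \<in> J \<beta> {0..m}"
    then obtain b where b: "is_rep \<beta> {0..m} x b"
      by (auto simp: J_def)
    let ?f = "\<lambda>i. of_int (b (Suc i)) / (- \<beta>) ^ Suc i"
    have "?f sums x" and dig: "\<And>i. 0 \<le> b (Suc i) \<and> b (Suc i) \<le> m"
      using b by (auto simp: is_rep_def)
    \<comment> \<open>Pairing each odd position with the next even one turns the bounds on the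
      digits into geometric series of positive ratio.\<close>
    then have "(\<lambda>n. sum ?f {n * 2..<n * 2 + 2}) sums x"
      by (intro sums_group) auto
    also have "(\<lambda>n. sum ?f {n * 2..<n * 2 + 2}) =
        (\<lambda>n. (of_int (b (2 * n + 2)) / \<beta>\<^sup>2 - of_int (b (2 * n + 1)) / \<beta>) * (1 / \<beta>\<^sup>2) ^ n)"
    proof
      fix n :: nat
      have "{n * 2..<n * 2 + 2} = {2 * n, 2 * n + 1}"
        by auto
      moreover have "(- \<beta>) ^ (2 * n) = \<beta>\<^sup>2 ^ n"
        by (simp add: power_mult)
      ultimately show "sum ?f {n * 2..<n * 2 + 2} =
        (of_int (b (2 * n + 2)) / \<beta>\<^sup>2 - of_int (b (2 * n + 1)) / \<beta>) * (1 / \<beta>\<^sup>2) ^ n"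
        using \<beta> by (simp add: power_divide divide_simps) (simp add: algebra_simps power2_eq_square)
    qed
    finally have S: "(\<lambda>n. (of_int (b (2 * n + 2)) / \<beta>\<^sup>2 - of_int (b (2 * n + 1)) / \<beta>) * (1 / \<beta>\<^sup>2) ^ n) sums x" .
    have G: "(\<lambda>n. a * (1 / \<beta>\<^sup>2) ^ n) sums (a * (\<beta>\<^sup>2 / (\<beta>\<^sup>2 - 1)))" for a
    proof -
      have "(\<lambda>n. (1 / \<beta>\<^sup>2) ^ n) sums (1 / (1 - 1 / \<beta>\<^sup>2))"
        using \<beta>2 by (intro geometric_sums) (simp add: divide_less_eq)
      also have "1 / (1 - 1 / \<beta>\<^sup>2) = \<beta>\<^sup>2 / (\<beta>\<^sup>2 - 1)"
        using \<beta> \<beta>2 by (simp add: field_simps)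
      finally show ?thesis
        by (rule sums_mult)
    qed
    have le: "of_int (b (2 * n + 2)) / \<beta>\<^sup>2 - of_int (b (2 * n + 1)) / \<beta> \<le> of_int m / \<beta>\<^sup>2"
      "- (of_int m / \<beta>) \<le> of_int (b (2 * n + 2)) / \<beta>\<^sup>2 - of_int (b (2 * n + 1)) / \<beta>" for n
    proof -
      have "of_int (b (2 * n + 2)) / \<beta>\<^sup>2 \<le> of_int m / \<beta>\<^sup>2" "0 \<le> of_int (b (2 * n + 2)) / \<beta>\<^sup>2"
        "of_int (b (2 * n + 1)) / \<beta> \<le> of_int m / \<beta>" "0 \<le> of_int (b (2 * n + 1)) / \<beta>"
        using dig[of "2 * n + 1"] dig[of "2 * n"] \<beta> by (simp_all add: divide_right_mono)
      then show "of_int (b (2 * n + 2)) / \<beta>\<^sup>2 - of_int (b (2 * n + 1)) / \<beta> \<le> of_int m / \<beta>\<^sup>2"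
        "- (of_int m / \<beta>) \<le> of_int (b (2 * n + 2)) / \<beta>\<^sup>2 - of_int (b (2 * n + 1)) / \<beta>"
        by linarith+
    qed
    have "x \<le> of_int m / \<beta>\<^sup>2 * (\<beta>\<^sup>2 / (\<beta>\<^sup>2 - 1))"
      using le(1) by (intro sums_le[OF _ S G] mult_right_mono) auto
    moreover have "- (of_int m / \<beta>) * (\<beta>\<^sup>2 / (\<beta>\<^sup>2 - 1)) \<le> x"
      using le(2) by (intro sums_le[OF _ G S] mult_right_mono) auto
    ultimately show "x \<in> {- \<beta> * r..r}"
      using \<beta> by (simp add: r_def power2_eq_square mult.commute)
  }
  {
    fix x assume x: "x \<in> {- \<beta> * r..r}"
    have ex: "\<exists>b\<in>{0..m}. - \<beta> * t - of_int b \<in> {- \<beta> * r..r}" if t: "t \<in> {- \<beta> * r..r}" for t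
    proof -
      have "\<beta> * t \<le> \<beta> * r" "\<beta> * (- \<beta> * r) \<le> \<beta> * t"
        using t \<beta> by (intro mult_left_mono; simp)+
      then have y: "- \<beta> * r \<le> - \<beta> * t" "- \<beta> * t \<le> of_int m + r"
        using r_eq by (simp_all add: power2_eq_square algebra_simps)
      \<comment> \<open>The largest digit whose remainder does not fall below the lower end.\<close>
      define b where "b = min m \<lfloor>- \<beta> * t + \<beta> * r\<rfloor>"
      have "0 \<le> \<lfloor>- \<beta> * t + \<beta> * r\<rfloor>"
        using y by simp
      then have "b \<in> {0..m}"
        using m0 by (auto simp: b_def)
      moreover have "- \<beta> * r \<le> - \<beta> * t - of_int b"
        unfolding b_def by linarith
      moreover have "- \<beta> * t - of_int b \<le> r"
      proof (cases "b = m")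
        case False
        then have "b = \<lfloor>- \<beta> * t + \<beta> * r\<rfloor>"
          by (simp add: b_def)
        then show ?thesis
          using len by linarith
      qed (use y in simp)
      ultimately show ?thesis
        by auto
    qed
    define g where "g t = (SOME b. b \<in> {0..m} \<and> - \<beta> * t - of_int b \<in> {- \<beta> * r..r})" for t
    have g: "g t \<in> {0..m}" "- \<beta> * t - of_int (g t) \<in> {- \<beta> * r..r}" if "t \<in> {- \<beta> * r..r}" for t
      using someI_ex[of "\<lambda>b. b \<in> {0..m} \<and> - \<beta> * t - of_int b \<in> {- \<beta> * r..r}"] ex[OF that]
      unfolding g_def by blast+
    define s where "s n = ((\<lambda>t. - \<beta> * t - of_int (g t)) ^^ n) x" for n
    have s: "s n \<in> {- \<beta> * r..r}" for n
    proof (induction n)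
      case 0
      then show ?case using x by (simp add: s_def)
    next
      case (Suc n)
      then show ?case using g(2)[of "s n"] by (simp add: s_def)
    qed
    define c where "c i = g (s (i - 1))" for i
    \<comment> \<open>The orbit \<open>s\<close> stays in the bounded interval, so the error term on
      the right tends to 0.\<close>
    have "(\<Sum>i<n. of_int (c (Suc i)) / (- \<beta>) ^ Suc i) = x - s n / (- \<beta>) ^ n" for n
    proof (induction n)
      case 0
      then show ?case by (simp add: s_def)
    next
      case (Suc n)
      have "s (Suc n) = - \<beta> * s n - of_int (g (s n))"
        by (simp add: s_def)
      then have "s n / (- \<beta>) ^ n = of_int (g (s n)) / (- \<beta>) ^ Suc n + s (Suc n) / (- \<beta>) ^ Suc n"
        using \<beta> by (simp add: field_simps)
      then show ?case
        unfolding sum.lessThan_Suc Suc by (simp add: c_def)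
    qed
    moreover have "(\<lambda>n. s n / (- \<beta>) ^ n) \<longlonglongrightarrow> 0"
    proof (rule Lim_null_comparison)
      show "\<forall>\<^sub>F n in sequentially. norm (s n / (- \<beta>) ^ n) \<le> \<beta> * r * (1 / \<beta>) ^ n"
      proof (intro always_eventually allI)
        fix n
        have "r \<ge> 0" using m0 \<beta>2 by (simp add: r_def)
        then have "r \<le> \<beta> * r"
          using \<beta> by (simp add: mult_le_cancel_right1)
        then have "\<bar>s n\<bar> \<le> \<beta> * r"
          using s[of n] by auto
        then show "norm (s n / (- \<beta>) ^ n) \<le> \<beta> * r * (1 / \<beta>) ^ n"
          using \<beta> by (simp add: abs_divide power_abs power_divide divide_right_mono)
      qed
      show "(\<lambda>n. \<beta> * r * (1 / \<beta>) ^ n) \<longlonglongrightarrow> 0"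
        using \<beta> by (intro tendsto_mult_right_zero LIMSEQ_realpow_zero) auto
    qed
    ultimately have "(\<lambda>i. of_int (c (Suc i)) / (- \<beta>) ^ Suc i) sums x"
      unfolding sums_def using tendsto_diff[OF tendsto_const, of _ 0 sequentially x] by simp
    moreover have "c i \<in> {0..m}" for i
      using g(1)[OF s] by (simp add: c_def)
    ultimately show "x \<in> J \<beta> {0..m}"
      by (auto simp: J_def is_rep_def)
  }
qed

section \<open>Remainders forbidden by optimality\<close>

text \<open>The bounds do not depend on \<open>x\<close>. Together they exclude the values of
  \<open>- \<beta> * x\<close> strictly between \<open>p + k\<close> and \<open>s + k\<close> for
  \<open>0 \<le> k < m\<close>: a first digit up to \<open>k\<close> fails by the first bound, a
  larger one by the second. The bound with \<open>s\<close> uses one step, the one with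
  \<open>p\<close> two steps.\<close>

lemma optimal_first_remainder_bounds:
  fixes \<beta> :: real and m :: int
  assumes \<beta>: "\<beta> > 1" and m: "of_int m < \<beta>" "\<beta> < of_int m + 1"
  shows "\<exists>p s. p < s \<and> (\<forall>x c. is_optimal_rep \<beta> {0..m} x c \<longrightarrow>
    (c 1 < m \<longrightarrow> - \<beta> * x - of_int (c 1) \<le> p) \<and> (0 < c 1 \<longrightarrow> s - 1 \<le> - \<beta> * x - of_int (c 1)))"
proof -
  define r where "r = of_int m / (\<beta>\<^sup>2 - 1)"
  define \<theta> where "\<theta> = \<beta> - of_int m"
  \<comment> \<open>If a remainder \<open>t\<close> is below \<open>s - 1\<close>, then
    \<open>t + 1\<close> is admissible and closer to 0, so the digit should have been smaller by
    1.\<close>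
  define s where "s = min r (1 / 2)"
  \<comment> \<open>For a remainder \<open>t\<close> above \<open>p\<close>, the three terms ensure
    in turn that \<open>\<theta> - \<beta> * t\<close> is smaller in absolute value than
    \<open>\<beta> * t\<close>, that \<open>t - 1\<close> is above the lower end of
    \<open>J\<close>, and that \<open>\<theta> - \<beta> * t\<close> is below its upper end.\<close>
  define p where "p = max (\<theta> / (2 * \<beta>)) (max (1 - \<beta> * r) ((\<theta> - r) / \<beta>))"
  have J: "J \<beta> {0..m} = {- \<beta> * r..r}"
    unfolding r_def using \<beta> m by (intro J_eq_interval) auto
  have \<theta>: "0 < \<theta>" "\<theta> < 1"
    using m by (auto simp: \<theta>_def)
  have m1: "m \<ge> 1"
    using \<beta> m by linarith
  have \<beta>2: "\<beta>\<^sup>2 > 1"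
    using \<beta> by simp
  have len: "1 < r + \<beta> * r"
  proof -
    have "\<beta>\<^sup>2 - 1 = (\<beta> + 1) * (\<beta> - 1)"
      by (simp add: power2_eq_square algebra_simps)
    then have "r + \<beta> * r = of_int m / (\<beta> - 1)"
      using \<beta> by (simp add: r_def divide_simps) (simp add: algebra_simps)
    then show ?thesis
      using \<beta> m by simp
  qed
  have r0: "r > 0"
    using m1 \<beta>2 by (simp add: r_def)
  have r_le: "r \<le> \<beta> * r"
    using r0 \<beta> by simp
  have ps: "p < s"
  proof -
    have "\<theta> < 2 * \<beta> * r"
    proof -
      have "\<theta> * (\<beta>\<^sup>2 - 1) < \<beta>\<^sup>2"
        using \<theta> \<beta>2 by (smt (verit) mult_left_le_one_le)
      also have "\<dots> \<le> \<beta> * (2 * of_int m)"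
        unfolding power2_eq_square using \<beta> m m1 by (intro mult_left_mono) auto
      finally show ?thesis
        using \<beta>2 by (simp add: r_def field_simps)
    qed
    moreover have "\<theta> / (2 * \<beta>) < 1 / 2"
      using \<theta> \<beta> by (simp add: field_simps)
    ultimately have "\<theta> / (2 * \<beta>) < s"
      using \<beta> by (simp add: s_def field_simps)
    moreover have "1 - \<beta> * r < s"
      using len r_le by (simp add: s_def)
    \<comment> \<open>If \<open>s = r\<close>, this follows from
      \<open>\<theta> < 1 < r + \<beta> * r\<close>; if \<open>s = 1 / 2 < r\<close>, from
      \<open>\<theta> - r < 1 / 2\<close>.\<close>
    moreover have "\<theta> - r < \<beta> * s"
      using len \<theta> \<beta> r0 by (cases "r \<le> 1 / 2") (auto simp: s_def min_def)
    then have "(\<theta> - r) / \<beta> < s"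
      using \<beta> by (simp add: field_simps)
    ultimately show ?thesis
      by (simp add: p_def)
  qed
  have "(c 1 < m \<longrightarrow> - \<beta> * x - of_int (c 1) \<le> p) \<and> (0 < c 1 \<longrightarrow> s - 1 \<le> - \<beta> * x - of_int (c 1))"
    if opt: "is_optimal_rep \<beta> {0..m} x c" for x c
  proof -
    define t where "t = - \<beta> * x - of_int (c 1)"
    have rep: "is_rep \<beta> {0..m} x c"
      using opt by (simp add: is_optimal_rep_def)
    then have dig: "c 1 \<in> {0..m}" "c 2 \<in> {0..m}"
      by (auto simp: is_rep_def)
    have "t \<in> J \<beta> {0..m}"
      using rep is_rep_shift_iff[of \<beta> "{0..m}" x c] \<beta> by (auto simp: J_def t_def)
    then have t: "- \<beta> * r \<le> t" "t \<le> r"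
      by (auto simp: J)
    have one: "\<bar>t\<bar> \<le> \<bar>t + of_int (c 1) - of_int b\<bar>"
      if "b \<in> {0..m}" "- \<beta> * r \<le> t + of_int (c 1) - of_int b" "t + of_int (c 1) - of_int b \<le> r" for b
      using optimal_first_digit[OF _ opt, of b] that \<beta> by (simp add: J t_def)
    have lower: "s - 1 \<le> t" if "0 < c 1"
    proof (rule ccontr)
      assume *: "\<not> s - 1 \<le> t"
      then have "t < - 1 / 2" "t + 1 \<le> r"
        by (auto simp: s_def min_def split: if_splits)
      moreover have "\<bar>t\<bar> \<le> \<bar>t + 1\<bar>"
        using one[of "c 1 - 1"] that dig t \<open>t + 1 \<le> r\<close> by simp
      ultimately show False
        by linarith
    qed
    have "t \<le> p" if c1: "c 1 < m"
    proof (rule ccontr)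
      assume *: "\<not> t \<le> p"
      have tp: "\<theta> < 2 * (\<beta> * t)" "1 - \<beta> * r < t" "\<theta> - r < \<beta> * t"
        using * \<beta> by (auto simp: p_def not_le pos_divide_less_eq algebra_simps)
      have "t \<le> r"
        using t by simp
      then have "\<beta> * t \<le> \<beta> * r"
        using \<beta> by simp
      \<comment> \<open>The digits \<open>c 1 + 1, m\<close> leave the remainder \<open>\<theta> - \<beta> * t\<close> after two steps, whereas every
        choice of \<open>c 2\<close> leaves at least \<open>\<beta> * t\<close> in absolute value.\<close>
      have eq: "- \<beta> * (- \<beta> * x - of_int (c 1 + 1)) - of_int m = \<theta> - \<beta> * t"
        by (simp add: t_def \<theta>_def algebra_simps)
      have "\<theta> - \<beta> * t \<in> J \<beta> {0..m}"
        using tp \<theta> \<open>\<beta> * t \<le> \<beta> * r\<close> by (auto simp: J)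
      then have "\<bar>- \<beta> * t - of_int (c 2)\<bar> \<le> \<bar>\<theta> - \<beta> * t\<bar>"
        using optimal_second_digit[OF _ opt, of "c 1 + 1" m] \<beta> dig c1 m1 unfolding eq t_def by simp
      moreover have "of_int (c 2) \<ge> (0::real)"
        using dig by simp
      ultimately show False
        using tp \<theta> by linarith
    qed
    then show ?thesis
      using lower by (simp add: t_def)
  qed
  then show ?thesis
    using ps by blast
qed

section \<open>The points with an optimal representation form a null set\<close>

theorem theorem2:
  fixes \<beta> :: real and A :: "int set"
  assumes "\<beta> > 1" and "\<beta> \<notin> \<nat>" and "A = {0..\<lfloor>\<beta>\<rfloor>}"
  shows "AE x in lebesgue. x \<in> J \<beta> A \<longrightarrow> \<not> (\<exists>c. is_optimal_rep \<beta> A x c)"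
proof -
  define m where "m = \<lfloor>\<beta>\<rfloor>"
  have A: "A = {0..m}"
    using assms(3) by (simp add: m_def)
  have "\<beta> \<noteq> of_int m"
    using assms(1,2) by (metis Ints_of_int Nats_altdef2 less_eq_real_def mem_Collect_eq less_trans zero_less_one)
  then have m: "of_int m < \<beta>" "\<beta> < of_int m + 1"
    unfolding m_def by linarith+
  obtain p s where ps: "p < s" and bounds: "\<And>x c. is_optimal_rep \<beta> A x c \<Longrightarrow>
      (c 1 < m \<longrightarrow> - \<beta> * x - of_int (c 1) \<le> p) \<and> (0 < c 1 \<longrightarrow> s - 1 \<le> - \<beta> * x - of_int (c 1))"
    using optimal_first_remainder_bounds[OF assms(1) m] A by metis
  define N where "N = {x. \<exists>c. is_optimal_rep \<beta> A x c}"
  define B where "B k = {x. (k < m \<longrightarrow> - \<beta> * x - of_int k \<le> p) \<and> (0 < k \<longrightarrow> s - 1 \<le> - \<beta> * x - of_int k)}" for k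
  \<comment> \<open>Passing to the closure needs no limit of optimal representations:
    \<open>X\<close> keeps only closed conditions on a digit, and it is a finite union, so it
    contains the closure of \<open>N\<close> as soon as it contains \<open>N\<close>.\<close>
  define X where "X = (\<Union>k\<in>A. B k \<inter> (\<lambda>x. - \<beta> * x - of_int k) -` closure N)"
  have "N \<subseteq> J \<beta> A"
    by (auto simp: N_def J_def is_optimal_rep_def)
  then have "bounded N"
    using J_eq_interval[OF assms(1), of m] m A by (metis bounded_closed_interval bounded_subset diff_less_eq less_imp_le)
  then have K: "compact (closure N)"
    by (rule compact_closure[THEN iffD2])
  have "N \<subseteq> X"
  proof
    fix x assume "x \<in> N"
    then obtain c where c: "is_optimal_rep \<beta> A x c"
      by (auto simp: N_def)
    have "c 1 \<in> A"
      using c by (auto simp: is_optimal_rep_def is_rep_def)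
    moreover have "x \<in> B (c 1)"
      using bounds[OF c] by (simp add: B_def)
    moreover have "- \<beta> * x - of_int (c 1) \<in> N"
      using optimal_tail[OF _ c] assms(1) by (auto simp: N_def)
    ultimately show "x \<in> X"
      unfolding X_def using closure_subset[of N] by blast
  qed
  moreover have "closed X"
  proof -
    have "closed (B k)" for k
      unfolding B_def by (intro closed_Collect_conj closed_Collect_imp open_Collect_const
          closed_Collect_le continuous_intros)
    moreover have "closed ((\<lambda>x. - \<beta> * x - of_int k) -` closure N)" for k
      by (intro closed_vimage continuous_intros) auto
    ultimately show ?thesis
      unfolding X_def by (intro closed_UN ballI closed_Int) (auto simp: A)
  qed
  ultimately have "closure N \<subseteq> X"
    by (simp add: closure_minimal)
  then have "\<forall>x\<in>closure N. \<exists>k. k \<in> A \<and> x \<in> B k \<and> - \<beta> * x - of_int k \<in> closure N"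
    by (auto simp: X_def)
  then obtain D where D: "\<And>x. x \<in> closure N \<Longrightarrow>
      D x \<in> A \<and> x \<in> B (D x) \<and> - \<beta> * x - of_int (D x) \<in> closure N"
    by metis
  \<comment> \<open>The length of the preimage of a forbidden band \<open>(p + j, s + j)\<close>
    under multiplication by \<open>- \<beta>\<close>.\<close>
  define \<delta> where "\<delta> = (s - p) / \<beta>"
  have "negligible (closure N)"
  proof (rule negligible_if_expanding_with_gaps[OF K assms(1)])
    show "\<delta> > 0"
      using ps assms(1) by (simp add: \<delta>_def)
    show "- \<beta> * x - of_int (D x) \<in> closure N" if "x \<in> closure N" for x
      using D[OF that] by simp
    fix x y
    assume xy: "x \<in> closure N" "y \<in> closure N" "x < y" "real_of_int (D x) \<noteq> of_int (D y)"
    \<comment> \<open>Points with digit at most \<open>j\<close> and points with digit above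
      \<open>j\<close> lie on opposite sides of the band belonging to \<open>j\<close>.\<close>
    have separated: "- \<beta> * v \<le> p + of_int j \<and> s + of_int j \<le> - \<beta> * w"
      if "v \<in> B i" "i \<le> j" "w \<in> B k" "j < k" "k \<in> A" "i \<in> A" for v w i j k
    proof -
      have "i < m" "0 < k" "of_int i \<le> (of_int j :: real)" "of_int j + 1 \<le> (of_int k :: real)"
        using that A by auto
      then show ?thesis
        using that(1,3) by (auto simp: B_def)
    qed
    \<comment> \<open>Multiplication by \<open>- \<beta>\<close> reverses the order, so the smaller
      point has the larger digit.\<close>
    have Dxy: "D y < D x"
    proof (rule ccontr)
      assume "\<not> D y < D x"
      then have "- \<beta> * x < - \<beta> * y"
        using separated[of x "D x" "D x" y "D y"] D xy ps by auto
      then show False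
        using xy(3) assms(1) by simp
    qed
    define j where "j = D y"
    define u where "u = - (s + of_int j) / \<beta>"
    have end_eq: "\<beta> * (u + \<delta>) = - (p + of_int j)" "\<beta> * u = - (s + of_int j)"
      using assms(1) by (simp_all add: u_def \<delta>_def field_simps)
    have "\<beta> * x \<le> \<beta> * u" "\<beta> * (u + \<delta>) \<le> \<beta> * y"
      unfolding end_eq using separated[of y j j x "D x"] D xy Dxy by (auto simp: j_def)
    \<comment> \<open>Whatever the digit of \<open>z\<close>, either \<open>x\<close> or
      \<open>y\<close> has a digit on the other side of \<open>j\<close>, so
      \<open>separated\<close> keeps \<open>z\<close> out of the band.\<close>
    moreover have "z \<notin> closure N" if "u < z" "z < u + \<delta>" for z
    proof
      assume z: "z \<in> closure N"
      have "\<beta> * u < \<beta> * z" "\<beta> * z < \<beta> * (u + \<delta>)"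
        using that assms(1) by simp_all
      then show False
        unfolding end_eq
        using separated[of y j j z "D z"] separated[of z "D z" j x "D x"] D[OF z] D[OF xy(1)] D[OF xy(2)] Dxy
        by (cases "D z \<le> j") (auto simp: j_def)
    qed
    ultimately show "\<exists>u\<ge>x. u + \<delta> \<le> y \<and> {u<..<u + \<delta>} \<inter> closure N = {}"
      using assms(1) by (intro exI[of _ u]) auto
  qed
  then have "closure N \<in> null_sets lebesgue"
    by (simp add: negligible_iff_null_sets)
  then show ?thesis
    using closure_subset[of N] by (intro AE_I'[of "closure N"]) (auto simp: N_def)
qed

end
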